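(* Let $\epsilon>0$. For any $0<\alpha\le1$ and $\frac{\alpha}{2}\le\beta\le\alpha$ there is a regularly self-intersecting set system $\mathcal{F}$ with $$\lg S(\mathcal{F})\le\max\Big\{\alpha,\ (1-\alpha)+\alpha H\Big(\tfrac{\beta}{\alpha}\Big)\Big\}+\epsilon,\qquad \lg P(\mathcal{F})\le H(\alpha)-(1-\beta)H\Big(\tfrac{\alpha-\beta}{1-\beta}\Big)+\epsilon.$$
   Context: $\lg=\log_2$; $H(x)=-x\lg x-(1-x)\lg(1-x)$ is the binary entropy function (with $H(0)=H(1)=0$). A set system over $[n]$ is a family $\mathcal{F}\subseteq2^{[n]}$; isomorphic set systems differ by a bijective relabeling of $[n]$. A permutation $\pi$ of $[n]$ has prefix-sets $\{\pi(1),\dots,\pi(i)\}$, $0\le i\le n$, and is supported by $\mathcal{F}$ if all of them lie in $\mathcal{F}$. $C(\mathcal{F})$ is the number of chains $S_0\subsetneq\dots\subsetneq S_n$ of members of $\mathcal{F}$; $S(\mathcal{F})=|\mathcal{F}|^{1/n}$; $P(\mathcal{F})=(n!/C(\mathcal{F}))^{1/n}$ (or $+\infty$ if $C(\mathcal{F})=0$). $\mathcal{F}_1,\mathcal{F}_2$ on the same ground set are regularly intersecting if there is $\mathcal{G}\subseteq\mathcal{F}_1\cap\mathcal{F}_2$ such that every permutation supported by both has a prefix-set in $\mathcal{G}$ and every permutation supported by $\mathcal{F}_1$ but not $\mathcal{F}_2$ has no prefix-set in $\mathcal{G}$; $\mathcal{F}$ is regularly self-intersecting if it is regularly intersecting with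 every set system isomorphic to it. *)

theory Defs
  imports Complex_Main "HOL-Library.Extended_Real" "HOL-Combinatorics.Permutations"
begin

definition bin_entropy :: "real \<Rightarrow> real" where
  "bin_entropy x = (if x = 0 \<or> x = 1 then 0
     else - x * log 2 x - (1 - x) * log 2 (1 - x))"

text \<open>The ground set \<open>[n]\<close> is \<open>{1..n}\<close>. A family does not determine its ground set,
  so the notions below carry \<open>n\<close> as an explicit parameter.\<close>

definition set_system :: "nat \<Rightarrow> nat set set \<Rightarrow> bool" where
  "set_system n F \<longleftrightarrow> F \<subseteq> Pow {1..n}"

definition isomorphic_systems :: "nat \<Rightarrow> nat set set \<Rightarrow> nat set set \<Rightarrow> bool" where
  "isomorphic_systems n F F' \<longleftrightarrow> (\<exists>\<sigma>. \<sigma> permutes {1..n} \<and> F' = (\<lambda>X. \<sigma> ` X) ` F)"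

definition prefix_sets :: "nat \<Rightarrow> (nat \<Rightarrow> nat) \<Rightarrow> nat set set" where
  "prefix_sets n \<pi> = {\<pi> ` {1..i} | i. i \<le> n}"

definition supported :: "nat \<Rightarrow> nat set set \<Rightarrow> (nat \<Rightarrow> nat) \<Rightarrow> bool" where
  "supported n F \<pi> \<longleftrightarrow> prefix_sets n \<pi> \<subseteq> F"

text \<open>A chain \<open>S\<^sub>0 \<subset> \<dots> \<subset> S\<^sub>n\<close> is encoded as the list \<open>[S\<^sub>0, \<dots>, S\<^sub>n]\<close>.\<close>

definition num_chains :: "nat \<Rightarrow> nat set set \<Rightarrow> nat" where
  "num_chains n F = card {Ss. length Ss = n + 1 \<and> set Ss \<subseteq> F \<and> sorted_wrt (\<subset>) Ss}"

definition S_val :: "nat \<Rightarrow> nat set set \<Rightarrow> real" where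
  "S_val n F = real (card F) powr (1 / real n)"

definition P_val :: "nat \<Rightarrow> nat set set \<Rightarrow> ereal" where
  "P_val n F = (if num_chains n F = 0 then \<infinity>
     else ereal ((fact n / real (num_chains n F)) powr (1 / real n)))"

text \<open>The binary logarithm on extended reals, so that an infinite \<open>P_val\<close> violates every
  real upper bound.\<close>

definition elg :: "ereal \<Rightarrow> ereal" where
  "elg x = (if x = \<infinity> then \<infinity> else if x \<le> 0 then - \<infinity> else ereal (log 2 (real_of_ereal x)))"

definition regularly_intersecting :: "nat \<Rightarrow> nat set set \<Rightarrow> nat set set \<Rightarrow> bool" where
  "regularly_intersecting n F\<^sub>1 F\<^sub>2 \<longleftrightarrow>
     (\<exists>G. G \<subseteq> F\<^sub>1 \<inter> F\<^sub>2 \<and>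
        (\<forall>\<pi>. \<pi> permutes {1..n} \<and> supported n F\<^sub>1 \<pi> \<and> supported n F\<^sub>2 \<pi>
             \<longrightarrow> prefix_sets n \<pi> \<inter> G \<noteq> {}) \<and>
        (\<forall>\<pi>. \<pi> permutes {1..n} \<and> supported n F\<^sub>1 \<pi> \<and> \<not> supported n F\<^sub>2 \<pi>
             \<longrightarrow> prefix_sets n \<pi> \<inter> G = {}))"

definition regularly_self_intersecting :: "nat \<Rightarrow> nat set set \<Rightarrow> bool" where
  "regularly_self_intersecting n F \<longleftrightarrow>
     (\<forall>F'. isomorphic_systems n F F' \<longrightarrow> regularly_intersecting n F F')"

end

theory Submission
  imports Defs "HOL-Real_Asymp.Real_Asymp"
begin

text \<open>
  Fix \<open>A \<subseteq> [n]\<close> with \<open>a \<approx> \<alpha>n\<close> elements and \<open>b \<approx> \<beta>n\<close>, and let the family consist of all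
  subsets of \<open>A\<close> together with all sets that meet \<open>A\<close> in at least \<open>b\<close> points. A permutation is
  supported iff its first \<open>b\<close> entries lie in \<open>A\<close>, so for the relabeled family given by \<open>A'\<close> the
  \<open>b\<close>-subsets of \<open>A \<inter> A'\<close> witness regular intersection. The family has at most
  \<open>2^a + 2^(n-a) * (\<Sum>k\<ge>b. a choose k)\<close> members. By symmetry, a random permutation is supported
  with probability \<open>(a choose b) / (n choose b) = ((n-b) choose (a-b)) / (n choose a)\<close>, and the
  latter form is the one whose exponent is the stated bound.

  Binomial coefficients are compared with the entropy without Stirling's formula: in the
  expansion of \<open>(k + l)^(k + l)\<close> the term with index \<open>k\<close> is the largest of \<open>k + l + 1\<close> terms.
\<close>

subsection \<open>Binomial coefficients and entropy\<close>

definition binomial_term :: "nat \<Rightarrow> nat \<Rightarrow> nat \<Rightarrow> nat" where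
  "binomial_term k l j = ((k + l) choose j) * (k ^ j * l ^ (k + l - j))"

lemma sum_binomial_term: "(\<Sum>j\<le>k + l. binomial_term k l j) = (k + l) ^ (k + l)"
  by (simp add: binomial binomial_term_def mult.assoc)

lemma binomial_term_Suc:
  assumes "j < k + l"
  shows "Suc j * l * binomial_term k l (Suc j) = (k + l - j) * k * binomial_term k l j"
proof -
  have absorb: "Suc j * ((k + l) choose Suc j) = (k + l - j) * ((k + l) choose j)"
    by (simp only: binomial_absorption binomial_absorb_comp)
  have power: "l * l ^ (k + l - Suc j) = l ^ (k + l - j)"
    using assms by (simp add: Suc_diff_Suc flip: power_Suc)
  have "Suc j * l * binomial_term k l (Suc j)
    = (Suc j * ((k + l) choose Suc j)) * (k * k ^ j) * (l * l ^ (k + l - Suc j))"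
    by (simp only: binomial_term_def power_Suc mult_ac)
  also have "\<dots> = (k + l - j) * k * binomial_term k l j"
    by (simp only: absorb power binomial_term_def mult_ac)
  finally show ?thesis .
qed

lemma binomial_term_le_Suc:
  assumes "j < k"
  shows "binomial_term k l j \<le> binomial_term k l (Suc j)"
proof (cases "l = 0")
  case True
  then show ?thesis
    using assms by (simp add: binomial_term_def power_0_left)
next
  case False
  have "Suc j * l \<le> k * (k + l - j)"
    using assms by (intro mult_le_mono) auto
  then have "Suc j * l * binomial_term k l j \<le> (k + l - j) * k * binomial_term k l j"
    by (intro mult_right_mono) (simp_all only: mult.commute)
  also have "\<dots> = Suc j * l * binomial_term k l (Suc j)"
    using assms by (intro binomial_term_Suc[symmetric]) simp
  finally show ?thesis
    using False by (simp del: mult_Suc)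
qed

lemma binomial_term_Suc_le:
  assumes "k \<le> j" and "j < k + l"
  shows "binomial_term k l (Suc j) \<le> binomial_term k l j"
proof -
  have "Suc j * l * binomial_term k l (Suc j) = (k + l - j) * k * binomial_term k l j"
    using assms(2) by (rule binomial_term_Suc)
  also have "\<dots> \<le> l * Suc j * binomial_term k l j"
    using assms by (intro mult_right_mono mult_le_mono) auto
  finally show ?thesis
    using assms by (simp add: mult.commute[of l] del: mult_Suc mult_Suc_right)
qed

lemma binomial_term_le_mode:
  assumes "j \<le> k + l"
  shows "binomial_term k l j \<le> binomial_term k l k"
proof (cases "j \<le> k")
  case True
  then show ?thesis
  proof (induction rule: inc_induct)
    case (step i)
    then show ?case
      using binomial_term_le_Suc[of i k l] by linarith
  qed simp
next
  case False
  then have "k \<le> j" by simp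
  then show ?thesis using assms
  proof (induction rule: dec_induct)
    case (step i)
    then show ?case
      using binomial_term_Suc_le[of k i l] by simp
  qed simp
qed

lemma choose_mult_powers_le: "((k + l) choose k) * (k ^ k * l ^ l) \<le> (k + l) ^ (k + l)"
proof -
  have "binomial_term k l k \<le> (\<Sum>j\<le>k + l. binomial_term k l j)"
    by (rule member_le_sum) auto
  then show ?thesis
    unfolding sum_binomial_term by (simp add: binomial_term_def)
qed

lemma power_le_choose_mult_powers:
  "(k + l) ^ (k + l) \<le> Suc (k + l) * (((k + l) choose k) * (k ^ k * l ^ l))"
proof -
  have "(\<Sum>j\<le>k + l. binomial_term k l j) \<le> card {..k + l} * binomial_term k l k"
    using sum_bounded_above[of "{..k + l}" "binomial_term k l" "binomial_term k l k"]
    by (simp add: binomial_term_le_mode)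
  then show ?thesis
    unfolding sum_binomial_term by (simp add: binomial_term_def)
qed

lemma sum_choose_mult_powers_le:
  assumes "l \<le> k"
  shows "(\<Sum>j=k..k + l. (k + l) choose j) * (k ^ k * l ^ l) \<le> (k + l) ^ (k + l)"
proof -
  have "k ^ k * l ^ l \<le> k ^ j * l ^ (k + l - j)" if j: "j \<in> {k..k + l}" for j
  proof -
    obtain d where d: "j = k + d" "d \<le> l"
      using j by (auto simp: le_iff_add)
    have "k ^ k * l ^ l = k ^ k * (l ^ d * l ^ (l - d))"
      using d by (simp flip: power_add)
    also have "\<dots> \<le> k ^ k * (k ^ d * l ^ (l - d))"
      using assms by (intro mult_le_mono power_mono) auto
    finally show ?thesis
      by (simp add: d power_add mult.assoc)
  qed
  then have "(\<Sum>j=k..k + l. (k + l) choose j) * (k ^ k * l ^ l)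
    \<le> (\<Sum>j=k..k + l. binomial_term k l j)"
    unfolding sum_distrib_right binomial_term_def by (intro sum_mono mult_left_mono) auto
  also have "\<dots> \<le> (\<Sum>j\<le>k + l. binomial_term k l j)"
    by (intro sum_mono2) auto
  finally show ?thesis
    unfolding sum_binomial_term .
qed

lemma mult_bin_entropy_divide:
  assumes "0 \<le> x" and "x \<le> y"
  shows "y * bin_entropy (x / y) = y * log 2 y - x * log 2 x - (y - x) * log 2 (y - x)"
proof (cases "x = 0 \<or> x = y")
  case True
  then show ?thesis
    by (auto simp: bin_entropy_def)
next
  case False
  then have "1 - x / y = (y - x) / y"
    using assms by (simp add: field_simps)
  then have "y * bin_entropy (x / y) = - x * log 2 (x / y) - (y - x) * log 2 ((y - x) / y)"
    using False assms by (simp add: bin_entropy_def right_diff_distrib)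
  also have "\<dots> = y * log 2 y - x * log 2 x - (y - x) * log 2 (y - x)"
    using False assms by (simp add: log_divide algebra_simps)
  finally show ?thesis .
qed

lemma powr_mult_bin_entropy:
  "2 powr (real (k + l) * bin_entropy (real k / real (k + l)))
    = real ((k + l) ^ (k + l)) / real (k ^ k * l ^ l)"
proof -
  have power: "2 powr (real m * log 2 (real m)) = real (m ^ m)" for m
    by (cases "m = 0") (simp_all add: mult.commute[of "real m"] powr_realpow flip: powr_powr)
  have "real (k + l) * bin_entropy (real k / real (k + l))
    = real (k + l) * log 2 (real (k + l)) - real k * log 2 (real k) - real l * log 2 (real l)"
    by (simp add: mult_bin_entropy_divide)
  then show ?thesis
    by (simp only: powr_diff power of_nat_mult divide_divide_eq_left)
qed

lemma log_le_mult_bin_entropy: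
  assumes "0 < m" and "m * (k ^ k * l ^ l) \<le> (k + l) ^ (k + l)"
  shows "log 2 (real m) \<le> real (k + l) * bin_entropy (real k / real (k + l))"
proof -
  have "0 < real (k ^ k * l ^ l)"
    by (auto simp del: of_nat_mult of_nat_power)
  then have "real m \<le> 2 powr (real (k + l) * bin_entropy (real k / real (k + l)))"
    unfolding powr_mult_bin_entropy using assms(2)
    by (simp only: pos_le_divide_eq of_nat_le_iff flip: of_nat_mult)
  then show ?thesis
    using assms(1) by (simp add: log_le_iff del: of_nat_add)
qed

lemma log_sum_choose_le:
  assumes "k \<le> n" and "n \<le> 2 * k"
  shows "log 2 (real (\<Sum>j=k..n. n choose j)) \<le> real n * bin_entropy (real k / real n)"
proof -
  obtain l where l: "n = k + l"
    using assms(1) le_Suc_ex by blast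
  have "0 < (n choose k)"
    using assms(1) by simp
  also have "\<dots> \<le> (\<Sum>j=k..n. n choose j)"
    using assms(1) by (intro member_le_sum) auto
  finally show ?thesis
    using assms(2) unfolding l by (intro log_le_mult_bin_entropy sum_choose_mult_powers_le) auto
qed

lemma log_choose_le:
  assumes "k \<le> n"
  shows "log 2 (real (n choose k)) \<le> real n * bin_entropy (real k / real n)"
proof -
  obtain l where l: "n = k + l"
    using assms le_Suc_ex by blast
  show ?thesis
    unfolding l by (intro log_le_mult_bin_entropy choose_mult_powers_le) simp
qed

lemma log_choose_ge:
  assumes "k \<le> n"
  shows "real n * bin_entropy (real k / real n) - log 2 (real n + 1) \<le> log 2 (real (n choose k))"
proof -
  obtain l where l: "n = k + l"
    using assms le_Suc_ex by blast
  have "0 < real (k ^ k * l ^ l)"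
    by (auto simp del: of_nat_mult of_nat_power)
  then have "2 powr (real n * bin_entropy (real k / real n)) \<le> real (Suc n * (n choose k))"
    unfolding l powr_mult_bin_entropy
    using power_le_choose_mult_powers[of k l]
    by (simp only: pos_divide_le_eq of_nat_le_iff mult.assoc flip: of_nat_mult)
  then have "real n * bin_entropy (real k / real n) \<le> log 2 (real (Suc n * (n choose k)))"
    using assms by (simp add: le_log_iff del: of_nat_mult mult_Suc)
  also have "\<dots> = log 2 (real n + 1) + log 2 (real (n choose k))"
    using assms by (simp add: log_mult_pos add.commute del: mult_Suc)
  finally show ?thesis
    by simp
qed

lemma continuous_on_mult_log: "continuous_on {0..} (\<lambda>x::real. x * log 2 x)"
  unfolding continuous_on_eq_continuous_within
proof
  fix x :: real
  assume "x \<in> {0..}"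
  show "continuous (at x within {0..}) (\<lambda>x. x * log 2 x)"
  proof (cases "x = 0")
    case True
    have "((\<lambda>x::real. x * log 2 x) \<longlongrightarrow> 0) (at_right 0)"
      by real_asymp
    then show ?thesis
      by (simp add: True continuous_within at_within_Ici_at_right)
  qed (use \<open>x \<in> {0..}\<close> in \<open>auto intro!: continuous_intros\<close>)
qed

subsection \<open>Permutations with prescribed images\<close>

lemma card_subset_atLeastAtMost_le: "A \<subseteq> {1..n} \<Longrightarrow> card A \<le> n"
  using card_mono[of "{1..n}" A] by simp

lemma permutes_image_subset: "\<pi> permutes S \<Longrightarrow> T \<subseteq> S \<Longrightarrow> \<pi> ` T \<subseteq> S"
  by (metis image_mono permutes_image)

lemma card_permutes_image: "\<pi> permutes S \<Longrightarrow> card (\<pi> ` T) = card T"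
  by (intro card_image permutes_inj_on)

lemma obtain_permutation_image_eq:
  assumes "finite S" and "A \<subseteq> S" and "B \<subseteq> S" and "card A = card B"
  obtains \<sigma> where "\<sigma> permutes S" and "\<sigma> ` A = B"
proof -
  have fin: "finite A" "finite B"
    using assms finite_subset by blast+
  obtain f where f: "bij_betw f A B"
    using finite_same_card_bij fin assms(4) by blast
  have "card (S - A) = card (S - B)"
    using assms fin by (simp add: card_Diff_subset)
  then obtain g where g: "bij_betw g (S - A) (S - B)"
    using finite_same_card_bij assms(1) by blast
  define \<sigma> where "\<sigma> x = (if x \<in> S then if x \<in> A then f x else g x else x)" for x
  have A: "bij_betw \<sigma> A B"
    using f assms(2) by (subst bij_betw_cong[of A \<sigma> f]) (auto simp: \<sigma>_def)
  have "bij_betw \<sigma> (S - A) (S - B)"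
    using g by (subst bij_betw_cong[of "S - A" \<sigma> g]) (auto simp: \<sigma>_def)
  with A have "bij_betw \<sigma> (A \<union> (S - A)) (B \<union> (S - B))"
    by (rule bij_betw_combine) auto
  then have "\<sigma> permutes S"
    using assms by (intro bij_imp_permutes) (simp_all add: Un_absorb1 \<sigma>_def)
  with A show thesis
    using that bij_betw_imp_surj_on by blast
qed

lemma card_permutes_image_eq:
  assumes "finite S" and "A \<subseteq> S" and "B \<subseteq> S" and "card A = card B"
  shows "card {\<pi>. \<pi> permutes S \<and> \<pi> ` T = A} = card {\<pi>. \<pi> permutes S \<and> \<pi> ` T = B}"
proof -
  have "card {\<pi>. \<pi> permutes S \<and> \<pi> ` T = A} \<le> card {\<pi>. \<pi> permutes S \<and> \<pi> ` T = B}"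
    if AB: "A \<subseteq> S" "B \<subseteq> S" "card A = card B" for A B
  proof -
    obtain \<sigma> where \<sigma>: "\<sigma> permutes S" "\<sigma> ` A = B"
      using obtain_permutation_image_eq[OF assms(1) AB] by blast
    show ?thesis
    proof (rule card_inj_on_le)
      show "inj_on ((\<circ>) \<sigma>) {\<pi>. \<pi> permutes S \<and> \<pi> ` T = A}"
        using fun.inj_map[OF permutes_inj[OF \<sigma>(1)]] by (rule inj_on_subset) simp
      show "(\<circ>) \<sigma> ` {\<pi>. \<pi> permutes S \<and> \<pi> ` T = A} \<subseteq> {\<pi>. \<pi> permutes S \<and> \<pi> ` T = B}"
        using \<sigma> by (auto intro: permutes_compose simp: image_comp[symmetric])
      show "finite {\<pi>. \<pi> permutes S \<and> \<pi> ` T = B}"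
        using finite_permutations[OF assms(1)] by simp
    qed
  qed
  then show ?thesis
    using assms by (intro antisym) auto
qed

lemma card_permutes_image_subset:
  assumes "finite S" and "A \<subseteq> S" and "T \<subseteq> S"
  shows "card {\<pi>. \<pi> permutes S \<and> \<pi> ` T \<subseteq> A}
    = (card A choose card T) * card {\<pi>. \<pi> permutes S \<and> \<pi> ` T = T}"
proof -
  let ?targets = "{B. B \<subseteq> A \<and> card B = card T}"
  have fin: "finite A"
    using assms finite_subset by blast
  have "{\<pi>. \<pi> permutes S \<and> \<pi> ` T \<subseteq> A} = (\<Union>B\<in>?targets. {\<pi>. \<pi> permutes S \<and> \<pi> ` T = B})"
    by (auto simp: card_permutes_image)
  also have "card \<dots> = (\<Sum>B\<in>?targets. card {\<pi>. \<pi> permutes S \<and> \<pi> ` T = B})"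
    using fin finite_permutations[OF assms(1)] by (intro card_UN_disjoint) auto
  also have "\<dots> = (\<Sum>B\<in>?targets. card {\<pi>. \<pi> permutes S \<and> \<pi> ` T = T})"
    using assms by (intro sum.cong refl card_permutes_image_eq) auto
  finally show ?thesis
    using fin by (simp add: n_subsets)
qed

lemma card_permutes_image_subset_mult_choose:
  assumes "finite S" and "A \<subseteq> S" and "T \<subseteq> S"
  shows "card {\<pi>. \<pi> permutes S \<and> \<pi> ` T \<subseteq> A} * (card S choose card T)
    = fact (card S) * (card A choose card T)"
proof -
  have "{\<pi>. \<pi> permutes S} = {\<pi>. \<pi> permutes S \<and> \<pi> ` T \<subseteq> S}"
    using assms(3) permutes_image_subset by blast
  then have "fact (card S) = (card S choose card T) * card {\<pi>. \<pi> permutes S \<and> \<pi> ` T = T}"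
    using card_permutations[OF refl assms(1)]
      card_permutes_image_subset[OF assms(1) subset_refl assms(3)]
    by simp
  then show ?thesis
    using card_permutes_image_subset[OF assms] by simp
qed

subsection \<open>Chains and supported permutations\<close>

definition full_chains :: "nat \<Rightarrow> nat set set \<Rightarrow> nat set list set" where
  "full_chains n F = {Ss. length Ss = n + 1 \<and> set Ss \<subseteq> F \<and> sorted_wrt (\<subset>) Ss}"

definition supported_permutations :: "nat \<Rightarrow> nat set set \<Rightarrow> (nat \<Rightarrow> nat) set" where
  "supported_permutations n F = {\<pi>. \<pi> permutes {1..n} \<and> supported n F \<pi>}"

definition prefix_chain :: "nat \<Rightarrow> (nat \<Rightarrow> nat) \<Rightarrow> nat set list" where
  "prefix_chain n \<pi> = map (\<lambda>i. \<pi> ` {1..i}) [0..<n + 1]"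

lemma length_prefix_chain: "length (prefix_chain n \<pi>) = n + 1"
  by (simp add: prefix_chain_def)

lemma nth_prefix_chain: "i \<le> n \<Longrightarrow> prefix_chain n \<pi> ! i = \<pi> ` {1..i}"
  by (simp add: prefix_chain_def del: upt_Suc)

lemma set_prefix_chain: "set (prefix_chain n \<pi>) = prefix_sets n \<pi>"
  by (auto simp: prefix_chain_def prefix_sets_def simp del: upt_Suc)

lemma prefix_chain_in_full_chains:
  assumes "\<pi> permutes {1..n}" and "supported n F \<pi>"
  shows "prefix_chain n \<pi> \<in> full_chains n F"
proof -
  have "\<pi> ` {1..i} \<subset> \<pi> ` {1..j}" if "i < j" for i j
    using that by (intro image_strict_mono permutes_inj_on[OF assms(1)]) auto
  then have "sorted_wrt (\<subset>) (prefix_chain n \<pi>)"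
    by (auto simp: sorted_wrt_iff_nth_less length_prefix_chain nth_prefix_chain)
  then show ?thesis
    using assms(2) by (simp add: full_chains_def length_prefix_chain set_prefix_chain supported_def)
qed

lemma inj_on_prefix_chain: "inj_on (prefix_chain n) {\<pi>. \<pi> permutes {1..n}}"
proof (rule inj_onI, rule ext)
  fix \<pi> \<rho> x
  assume "\<pi> \<in> {\<pi>. \<pi> permutes {1..n}}" and "\<rho> \<in> {\<pi>. \<pi> permutes {1..n}}"
    and chain_eq: "prefix_chain n \<pi> = prefix_chain n \<rho>"
  then have perm: "\<pi> permutes {1..n}" "\<rho> permutes {1..n}" by auto
  show "\<pi> x = \<rho> x"
  proof (cases "x \<in> {1..n}")
    case True
    have entry: "{\<tau> x} = \<tau> ` {1..x} - \<tau> ` {1..x - 1}" if "\<tau> permutes {1..n}" for \<tau> :: "nat \<Rightarrow> nat"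
    proof -
      have "{1..x} - {1..x - 1} = {x}"
        using True by auto
      then show ?thesis
        by (metis image_set_diff permutes_inj[OF that] image_empty image_insert)
    qed
    have nth: "\<tau> ` {1..x} = prefix_chain n \<tau> ! x"
      "\<tau> ` {1..x - 1} = prefix_chain n \<tau> ! (x - 1)" for \<tau>
      using True by (auto simp: nth_prefix_chain simp del: One_nat_def)
    have "{\<pi> x} = {\<rho> x}"
      unfolding entry[OF perm(1)] entry[OF perm(2)] nth chain_eq ..
    then show ?thesis by simp
  next
    case False
    then show ?thesis
      using perm by (simp add: permutes_not_in)
  qed
qed

lemma nth_full_chain_psubset: "Ss \<in> full_chains n F \<Longrightarrow> i < j \<Longrightarrow> j \<le> n \<Longrightarrow> Ss ! i \<subset> Ss ! j"
  by (simp add: full_chains_def sorted_wrt_nth_less)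

lemma nth_full_chain_subset:
  "set_system n F \<Longrightarrow> Ss \<in> full_chains n F \<Longrightarrow> i \<le> n \<Longrightarrow> Ss ! i \<subseteq> {1..n}"
  by (force simp: set_system_def full_chains_def)

lemma card_nth_full_chain:
  assumes "set_system n F" and "Ss \<in> full_chains n F" and "i \<le> n"
  shows "card (Ss ! i) = i"
proof -
  note sub = nth_full_chain_subset[OF assms(1,2)]
  have growth: "card (Ss ! j) + (k - j) \<le> card (Ss ! k)" if "j \<le> k" "k \<le> n" for j k
    using that
  proof (induction k rule: dec_induct)
    case (step k)
    then have "Ss ! k \<subset> Ss ! Suc k"
      using nth_full_chain_psubset[OF assms(2)] by simp
    then have "card (Ss ! k) < card (Ss ! Suc k)"
      using step.prems sub finite_subset by (intro psubset_card_mono) blast+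
    then show ?case
      using step by simp
  qed simp
  have "card (Ss ! n) \<le> n"
    using sub by (rule card_subset_atLeastAtMost_le) simp
  then show ?thesis
    using growth[of 0 i] growth[of i n] assms(3) by simp
qed

lemma nth_full_chain_insert:
  assumes F: "set_system n F" and Ss: "Ss \<in> full_chains n F" and i: "i \<in> {1..n}"
  shows "\<exists>x. Ss ! i = insert x (Ss ! (i - 1))"
proof -
  have sub_pred: "Ss ! (i - 1) \<subseteq> Ss ! i"
    using nth_full_chain_psubset[OF Ss, of "i - 1" i] i by auto
  moreover have "finite (Ss ! (i - 1))"
    using nth_full_chain_subset[OF F Ss, of "i - 1"] i finite_subset by fastforce
  ultimately have "card (Ss ! i - Ss ! (i - 1)) = 1"
    using i card_nth_full_chain[OF F Ss, of i] card_nth_full_chain[OF F Ss, of "i - 1"]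
    by (subst card_Diff_subset) auto
  then obtain x where "Ss ! i - Ss ! (i - 1) = {x}"
    using card_1_singletonE by blast
  with sub_pred show ?thesis by blast
qed

lemma obtain_permutation_prefix_chain_eq:
  assumes F: "set_system n F" and Ss: "Ss \<in> full_chains n F"
  obtains \<pi> where "\<pi> permutes {1..n}" and "prefix_chain n \<pi> = Ss"
proof -
  obtain f where f: "Ss ! i = insert (f i) (Ss ! (i - 1))" if "i \<in> {1..n}" for i
    using nth_full_chain_insert[OF F Ss] by metis
  have image_f: "f ` {1..i} = Ss ! i" if "i \<le> n" for i
    using that
  proof (induction i)
    case 0
    have "finite (Ss ! 0)"
      using nth_full_chain_subset[OF F Ss, of 0] finite_subset by blast
    then show ?case
      using card_nth_full_chain[OF F Ss, of 0] by simp
  next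
    case (Suc i)
    then show ?case
      using f[of "Suc i"] by (simp add: atLeastAtMostSuc_conv)
  qed
  define \<pi> where "\<pi> i = (if i \<in> {1..n} then f i else i)" for i
  have image: "\<pi> ` {1..i} = Ss ! i" if "i \<le> n" for i
    unfolding image_f[OF that, symmetric] using that by (intro image_cong) (auto simp: \<pi>_def)
  have "Ss ! n = {1..n}"
    using card_nth_full_chain[OF F Ss, of n] nth_full_chain_subset[OF F Ss, of n]
    by (intro card_subset_eq) simp_all
  then have "\<pi> ` {1..n} = {1..n}"
    using image[of n] by simp
  then have "bij_betw \<pi> {1..n} {1..n}"
    by (simp add: bij_betw_def eq_card_imp_inj_on)
  then have "\<pi> permutes {1..n}"
    by (rule bij_imp_permutes) (auto simp: \<pi>_def)
  moreover have "prefix_chain n \<pi> = Ss"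
    using Ss by (intro nth_equalityI)
      (simp_all add: length_prefix_chain nth_prefix_chain image full_chains_def del: One_nat_def)
  ultimately show thesis
    using that by blast
qed

lemma bij_betw_prefix_chain:
  assumes "set_system n F"
  shows "bij_betw (prefix_chain n) (supported_permutations n F) (full_chains n F)"
proof (intro bij_betw_imageI)
  show "inj_on (prefix_chain n) (supported_permutations n F)"
    using inj_on_prefix_chain by (rule inj_on_subset) (auto simp: supported_permutations_def)
  have "Ss \<in> prefix_chain n ` supported_permutations n F" if Ss: "Ss \<in> full_chains n F" for Ss
  proof -
    obtain \<pi> where \<pi>: "\<pi> permutes {1..n}" "prefix_chain n \<pi> = Ss"
      using obtain_permutation_prefix_chain_eq[OF assms Ss] .
    then have "supported n F \<pi>"
      using Ss by (auto simp: supported_def full_chains_def set_prefix_chain)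
    with \<pi> show ?thesis by (auto simp: supported_permutations_def)
  qed
  then show "prefix_chain n ` supported_permutations n F = full_chains n F"
    using prefix_chain_in_full_chains by (auto simp: supported_permutations_def)
qed

lemma num_chains_eq_card_supported_permutations:
  assumes "set_system n F"
  shows "num_chains n F = card (supported_permutations n F)"
  using bij_betw_same_card[OF bij_betw_prefix_chain[OF assms]]
  by (simp add: num_chains_def full_chains_def)

subsection \<open>Front systems\<close>

definition front_system :: "nat \<Rightarrow> nat set \<Rightarrow> nat \<Rightarrow> nat set set" where
  "front_system n A b = {X. X \<subseteq> {1..n} \<and> (X \<subseteq> A \<or> b \<le> card (X \<inter> A))}"

lemma set_system_front_system: "set_system n (front_system n A b)"
  by (auto simp: set_system_def front_system_def)

lemma finite_front_system: "finite (front_system n A b)"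
  by (simp add: front_system_def)

lemma empty_in_front_system: "{} \<in> front_system n A b"
  by (simp add: front_system_def)

lemma supported_front_system_iff:
  assumes \<pi>: "\<pi> permutes {1..n}" and "b \<le> n"
  shows "supported n (front_system n A b) \<pi> \<longleftrightarrow> \<pi> ` {1..b} \<subseteq> A"
proof
  assume "supported n (front_system n A b) \<pi>"
  then have "\<pi> ` {1..b} \<in> front_system n A b"
    using \<open>b \<le> n\<close> by (auto simp: supported_def prefix_sets_def)
  then consider "\<pi> ` {1..b} \<subseteq> A" | "b \<le> card (\<pi> ` {1..b} \<inter> A)"
    by (auto simp: front_system_def)
  then show "\<pi> ` {1..b} \<subseteq> A"
  proof cases
    case 2
    then have "\<pi> ` {1..b} \<inter> A = \<pi> ` {1..b}"
      by (intro card_seteq) (simp_all add: card_permutes_image[OF \<pi>])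
    then show ?thesis by blast
  qed
next
  assume front: "\<pi> ` {1..b} \<subseteq> A"
  have "\<pi> ` {1..i} \<subseteq> A \<or> b \<le> card (\<pi> ` {1..i} \<inter> A)" for i
  proof (cases "i \<le> b")
    case True
    then have "\<pi> ` {1..i} \<subseteq> \<pi> ` {1..b}"
      by (intro image_mono) simp
    then show ?thesis
      using front by blast
  next
    case False
    then have "\<pi> ` {1..b} \<subseteq> \<pi> ` {1..i} \<inter> A"
      using front by auto
    then have "card (\<pi> ` {1..b}) \<le> card (\<pi> ` {1..i} \<inter> A)"
      by (intro card_mono) auto
    then show ?thesis
      by (simp add: card_permutes_image[OF \<pi>])
  qed
  moreover have "\<pi> ` {1..i} \<subseteq> {1..n}" if "i \<le> n" for i
    using that by (intro permutes_image_subset[OF \<pi>]) simp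
  ultimately show "supported n (front_system n A b) \<pi>"
    unfolding supported_def prefix_sets_def front_system_def by blast
qed

lemma image_in_front_system:
  assumes \<sigma>: "\<sigma> permutes {1..n}" and "X \<in> front_system n A b"
  shows "\<sigma> ` X \<in> front_system n (\<sigma> ` A) b"
proof -
  have "card (\<sigma> ` X \<inter> \<sigma> ` A) = card (X \<inter> A)"
    by (simp add: card_permutes_image[OF \<sigma>] flip: image_Int[OF permutes_inj[OF \<sigma>]])
  then show ?thesis
    using assms permutes_image_subset[OF \<sigma>] by (auto simp: front_system_def)
qed

lemma image_front_system:
  assumes \<sigma>: "\<sigma> permutes {1..n}"
  shows "(`) \<sigma> ` front_system n A b = front_system n (\<sigma> ` A) b"
proof
  show "(`) \<sigma> ` front_system n A b \<subseteq> front_system n (\<sigma> ` A) b"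
    using image_in_front_system[OF \<sigma>] by blast
  show "front_system n (\<sigma> ` A) b \<subseteq> (`) \<sigma> ` front_system n A b"
  proof
    fix Y
    assume "Y \<in> front_system n (\<sigma> ` A) b"
    then have "inv \<sigma> ` Y \<in> front_system n A b"
      using image_in_front_system[OF permutes_inv[OF \<sigma>], of Y "\<sigma> ` A" b]
      by (simp add: image_comp permutes_inv_o[OF \<sigma>])
    moreover have "Y = \<sigma> ` inv \<sigma> ` Y"
      by (simp add: image_f_inv_f permutes_surj[OF \<sigma>])
    ultimately show "Y \<in> (`) \<sigma> ` front_system n A b"
      by blast
  qed
qed

lemma prefix_sets_meet_subsets_of_card_iff:
  assumes \<pi>: "\<pi> permutes {1..n}" and "b \<le> n"
  shows "prefix_sets n \<pi> \<inter> {X. X \<subseteq> A \<and> card X = b} \<noteq> {} \<longleftrightarrow> \<pi> ` {1..b} \<subseteq> A"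
proof
  assume "prefix_sets n \<pi> \<inter> {X. X \<subseteq> A \<and> card X = b} \<noteq> {}"
  then obtain i where "\<pi> ` {1..i} \<subseteq> A" and "card (\<pi> ` {1..i}) = b"
    unfolding prefix_sets_def by blast
  then show "\<pi> ` {1..b} \<subseteq> A"
    by (simp add: card_permutes_image[OF \<pi>])
next
  assume "\<pi> ` {1..b} \<subseteq> A"
  then have "\<pi> ` {1..b} \<in> {X. X \<subseteq> A \<and> card X = b}"
    by (simp add: card_permutes_image[OF \<pi>])
  moreover have "\<pi> ` {1..b} \<in> prefix_sets n \<pi>"
    using \<open>b \<le> n\<close> by (auto simp: prefix_sets_def)
  ultimately show "prefix_sets n \<pi> \<inter> {X. X \<subseteq> A \<and> card X = b} \<noteq> {}"
    by blast
qed

lemma regularly_intersecting_front_systems: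
  assumes "A \<subseteq> {1..n}" and "b \<le> n"
  shows "regularly_intersecting n (front_system n A b) (front_system n B b)"
  unfolding regularly_intersecting_def
proof (intro exI conjI allI impI)
  let ?G = "{X. X \<subseteq> A \<inter> B \<and> card X = b}"
  show "?G \<subseteq> front_system n A b \<inter> front_system n B b"
    using assms(1) by (auto simp: front_system_def)
  have meet: "prefix_sets n \<pi> \<inter> ?G \<noteq> {} \<longleftrightarrow>
      supported n (front_system n A b) \<pi> \<and> supported n (front_system n B b) \<pi>"
    if "\<pi> permutes {1..n}" for \<pi>
    using prefix_sets_meet_subsets_of_card_iff[OF that assms(2), of "A \<inter> B"]
    by (simp add: supported_front_system_iff[OF that assms(2)])
  show "prefix_sets n \<pi> \<inter> ?G \<noteq> {}"
    if "\<pi> permutes {1..n} \<and> supported n (front_system n A b) \<pi>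
      \<and> supported n (front_system n B b) \<pi>" for \<pi>
    using that meet by blast
  show "prefix_sets n \<pi> \<inter> ?G = {}"
    if "\<pi> permutes {1..n} \<and> supported n (front_system n A b) \<pi>
      \<and> \<not> supported n (front_system n B b) \<pi>" for \<pi>
    using that meet by blast
qed

lemma regularly_self_intersecting_front_system:
  "A \<subseteq> {1..n} \<Longrightarrow> b \<le> n \<Longrightarrow> regularly_self_intersecting n (front_system n A b)"
  by (auto simp: regularly_self_intersecting_def isomorphic_systems_def image_front_system
      intro: regularly_intersecting_front_systems simp del: One_nat_def)

lemma num_chains_front_system_mult_choose:
  assumes "A \<subseteq> {1..n}" and "b \<le> n"
  shows "num_chains n (front_system n A b) * (n choose b) = fact n * (card A choose b)"
proof -
  have "num_chains n (front_system n A b) = card (supported_permutations n (front_system n A b))"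
    using set_system_front_system by (rule num_chains_eq_card_supported_permutations)
  also have "supported_permutations n (front_system n A b)
    = {\<pi>. \<pi> permutes {1..n} \<and> \<pi> ` {1..b} \<subseteq> A}"
    unfolding supported_permutations_def using assms(2) supported_front_system_iff by blast
  finally show ?thesis
    using card_permutes_image_subset_mult_choose[of "{1..n}" A "{1..b}"] assms by simp
qed

lemma num_chains_front_system_pos:
  assumes "A \<subseteq> {1..n}" and "b \<le> card A"
  shows "0 < num_chains n (front_system n A b)"
proof -
  have "card A \<le> n"
    using assms(1) by (rule card_subset_atLeastAtMost_le)
  then have "0 < num_chains n (front_system n A b) * (n choose b)"
    using assms by (subst num_chains_front_system_mult_choose) auto
  then show ?thesis by simp
qed

lemma fact_div_num_chains_front_system:
  assumes "A \<subseteq> {1..n}" and "b \<le> card A"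
  shows "fact n / real (num_chains n (front_system n A b))
    = real (n choose card A) / real ((n - b) choose (card A - b))"
proof -
  let ?N = "num_chains n (front_system n A b)"
  have "card A \<le> n"
    using assms(1) by (rule card_subset_atLeastAtMost_le)
  have "?N * (n choose b) * ((n - b) choose (card A - b))
    = ?N * ((n choose card A) * (card A choose b))"
    using choose_mult[OF assms(2) \<open>card A \<le> n\<close>] by simp
  moreover have "?N * (n choose b) = fact n * (card A choose b)"
    using assms \<open>card A \<le> n\<close> by (intro num_chains_front_system_mult_choose) auto
  ultimately have "fact n * ((n - b) choose (card A - b)) = ?N * (n choose card A)"
    using assms(2) by simp
  then have "fact n * real ((n - b) choose (card A - b)) = real ?N * real (n choose card A)"
    by (metis of_nat_fact of_nat_mult)
  moreover have "0 < real ((n - b) choose (card A - b))"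
    using assms(2) \<open>card A \<le> n\<close> by simp
  moreover have "0 < real ?N"
    using num_chains_front_system_pos[OF assms] by simp
  ultimately show ?thesis
    by (simp add: field_simps)
qed

lemma elg_P_val_front_system:
  assumes "A \<subseteq> {1..n}" and "b \<le> card A"
  shows "elg (P_val n (front_system n A b))
    = ereal ((log 2 (real (n choose card A))
        - log 2 (real ((n - b) choose (card A - b)))) / real n)"
proof -
  have "card A \<le> n"
    using assms(1) by (rule card_subset_atLeastAtMost_le)
  have "elg (P_val n (front_system n A b))
    = ereal (log 2 (fact n / real (num_chains n (front_system n A b))) / real n)"
    using num_chains_front_system_pos[OF assms] by (simp add: elg_def P_val_def log_powr)
  then show ?thesis
    using assms \<open>card A \<le> n\<close> by (simp add: fact_div_num_chains_front_system log_divide_pos)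
qed

lemma card_subsets_card_ge:
  assumes "finite A"
  shows "card {Y. Y \<subseteq> A \<and> b \<le> card Y} = (\<Sum>k=b..card A. card A choose k)"
proof -
  have "{Y. Y \<subseteq> A \<and> b \<le> card Y} = (\<Union>k\<in>{b..card A}. {Y. Y \<subseteq> A \<and> card Y = k})"
    using assms by (auto intro: card_mono)
  also have "card \<dots> = (\<Sum>k=b..card A. card {Y. Y \<subseteq> A \<and> card Y = k})"
    by (rule card_UN_disjoint) (use assms in auto)
  finally show ?thesis
    using assms by (simp add: n_subsets)
qed

lemma card_front_system_le:
  assumes "A \<subseteq> {1..n}"
  shows "card (front_system n A b)
    \<le> 2 ^ card A + 2 ^ (n - card A) * (\<Sum>k=b..card A. card A choose k)"
proof -
  have fin: "finite A"
    using assms finite_subset by blast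
  let ?large = "{X. X \<subseteq> {1..n} \<and> b \<le> card (X \<inter> A)}"
  let ?parts = "Pow ({1..n} - A) \<times> {Y. Y \<subseteq> A \<and> b \<le> card Y}"
  have "front_system n A b \<subseteq> Pow A \<union> ?large"
    by (auto simp: front_system_def)
  then have "card (front_system n A b) \<le> card (Pow A \<union> ?large)"
    using fin by (intro card_mono) auto
  also have "\<dots> \<le> card (Pow A) + card ?large"
    by (rule card_Un_le)
  also have "card ?large \<le> card ?parts"
  proof (rule card_inj_on_le)
    show "inj_on (\<lambda>X. (X - A, X \<inter> A)) ?large"
      by (rule inj_onI) blast
    show "(\<lambda>X. (X - A, X \<inter> A)) ` ?large \<subseteq> ?parts"
      by auto
    show "finite ?parts"
      using fin by simp
  qed
  also have "card ?parts = 2 ^ (n - card A) * (\<Sum>k=b..card A. card A choose k)"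
    using assms fin
    by (simp add: card_cartesian_product card_Pow card_Diff_subset card_subsets_card_ge)
  finally show ?thesis
    using fin by (simp add: card_Pow)
qed

lemma log_S_val_front_system_le:
  assumes "A \<subseteq> {1..n}" and "b \<le> card A" and "card A \<le> 2 * b"
  defines "a \<equiv> real (card A)"
  shows "log 2 (S_val n (front_system n A b))
    \<le> (1 + max a (real n - a + a * bin_entropy (real b / a))) / real n"
proof -
  let ?tail = "\<Sum>k=b..card A. card A choose k" and ?h = "a * bin_entropy (real b / a)"
  have "card A \<le> n"
    using assms(1) by (rule card_subset_atLeastAtMost_le)
  have "0 < (card A choose b)"
    using assms(2) by simp
  also have "\<dots> \<le> ?tail"
    using assms(2) by (intro member_le_sum) auto
  finally have "real ?tail \<le> 2 powr ?h"
    using log_sum_choose_le[OF assms(2,3)] unfolding a_def by (simp only: log_le_iff)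
  have "real (card (front_system n A b)) \<le> 2 ^ card A + 2 ^ (n - card A) * real ?tail"
    using of_nat_mono[OF card_front_system_le[OF assms(1), of b]] by simp
  also have "\<dots> \<le> 2 ^ card A + 2 ^ (n - card A) * 2 powr ?h"
    using \<open>real ?tail \<le> 2 powr ?h\<close> by simp
  also have "\<dots> = 2 powr a + 2 powr (real n - a + ?h)"
    using \<open>card A \<le> n\<close> by (simp add: a_def of_nat_diff powr_add flip: powr_realpow)
  also have "\<dots> \<le> 2 * 2 powr max a (real n - a + ?h)"
    by (simp add: max_def)
  also have "\<dots> = 2 powr (1 + max a (real n - a + ?h))"
    by (simp add: powr_add)
  finally have "real (card (front_system n A b)) \<le> 2 powr (1 + max a (real n - a + ?h))" .
  moreover have "0 < card (front_system n A b)"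
    using finite_front_system empty_in_front_system by (metis card_gt_0_iff empty_iff)
  ultimately show ?thesis
    by (simp add: S_val_def log_powr log_le_iff divide_right_mono)
qed

subsection \<open>Asymptotics\<close>

text \<open>
  The case \<open>\<mu> = 0\<close> is included: it forces \<open>\<kappa> = 0\<close>, and \<open>\<kappa> / \<mu>\<close> is then \<open>0\<close>. It occurs for
  \<open>\<alpha> = \<beta> = 1\<close>, where \<open>(\<alpha> - \<beta>) / (1 - \<beta>)\<close> has denominator \<open>0\<close>.
\<close>

lemma tendsto_mult_bin_entropy_ratio:
  fixes k m :: "nat \<Rightarrow> nat"
  assumes le: "\<And>n. k n \<le> m n"
    and m: "(\<lambda>n. real (m n) / real n) \<longlonglongrightarrow> \<mu>"
    and k: "(\<lambda>n. real (k n) / real n) \<longlonglongrightarrow> \<kappa>"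
  shows "(\<lambda>n. real (m n) * bin_entropy (real (k n) / real (m n)) / real n)
    \<longlonglongrightarrow> \<mu> * bin_entropy (\<kappa> / \<mu>)"
proof -
  have "0 \<le> \<kappa>"
    using k by (rule LIMSEQ_le_const) simp
  have "\<kappa> \<le> \<mu>"
    using k m by (rule LIMSEQ_le) (use le in \<open>simp add: divide_right_mono\<close>)
  have mult_log: "(\<lambda>n. x n * log 2 (x n)) \<longlonglongrightarrow> l * log 2 l"
    if "x \<longlonglongrightarrow> l" and "\<And>n. 0 \<le> x n" for x :: "nat \<Rightarrow> real" and l
    using that LIMSEQ_le_const[OF that(1), of 0]
    by (intro continuous_on_tendsto_compose[OF continuous_on_mult_log]) auto
  define x y where "x n = real (k n) / real n" and "y n = real (m n) / real n" for n
  have xy: "0 \<le> x n" "x n \<le> y n" for n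
    using le by (simp_all add: x_def y_def divide_right_mono)
  have "real (m n) * bin_entropy (real (k n) / real (m n)) / real n
    = y n * log 2 (y n) - x n * log 2 (x n) - (y n - x n) * log 2 (y n - x n)" for n
    unfolding mult_bin_entropy_divide[OF xy, symmetric] by (cases "n = 0") (simp_all add: x_def y_def)
  moreover have "(\<lambda>n. y n * log 2 (y n) - x n * log 2 (x n) - (y n - x n) * log 2 (y n - x n))
    \<longlonglongrightarrow> \<mu> * log 2 \<mu> - \<kappa> * log 2 \<kappa> - (\<mu> - \<kappa>) * log 2 (\<mu> - \<kappa>)"
    using k m xy order_trans[OF xy] unfolding x_def[symmetric] y_def[symmetric]
    by (intro tendsto_diff mult_log) simp_all
  ultimately show ?thesis
    using \<open>0 \<le> \<kappa>\<close> \<open>\<kappa> \<le> \<mu>\<close> by (simp add: mult_bin_entropy_divide)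
qed

lemma tendsto_log_choose:
  fixes k m :: "nat \<Rightarrow> nat"
  assumes le: "\<And>n. k n \<le> m n" "\<And>n. m n \<le> n"
    and m: "(\<lambda>n. real (m n) / real n) \<longlonglongrightarrow> \<mu>"
    and k: "(\<lambda>n. real (k n) / real n) \<longlonglongrightarrow> \<kappa>"
  shows "(\<lambda>n. log 2 (real (m n choose k n)) / real n) \<longlonglongrightarrow> \<mu> * bin_entropy (\<kappa> / \<mu>)"
proof (rule tendsto_sandwich)
  let ?h = "\<lambda>n. real (m n) * bin_entropy (real (k n) / real (m n))"
  have "?h n - log 2 (real n + 1) \<le> log 2 (real (m n choose k n))" for n
  proof -
    have "log 2 (real (m n) + 1) \<le> log 2 (real n + 1)"
      using le(2) by simp
    then show ?thesis
      using log_choose_ge[OF le(1), of n] by linarith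
  qed
  then show "\<forall>\<^sub>F n in sequentially. ?h n / real n - log 2 (real n + 1) / real n
      \<le> log 2 (real (m n choose k n)) / real n"
    by (intro always_eventually allI) (simp add: divide_right_mono flip: diff_divide_distrib)
  show "\<forall>\<^sub>F n in sequentially. log 2 (real (m n choose k n)) / real n \<le> ?h n / real n"
    using log_choose_le[OF le(1)] by (intro always_eventually allI divide_right_mono) auto
  show h: "(\<lambda>n. ?h n / real n) \<longlonglongrightarrow> \<mu> * bin_entropy (\<kappa> / \<mu>)"
    using le(1) m k by (rule tendsto_mult_bin_entropy_ratio)
  have "(\<lambda>n. log 2 (real n + 1) / real n) \<longlonglongrightarrow> 0"
    by real_asymp
  from tendsto_diff[OF h this]
  show "(\<lambda>n. ?h n / real n - log 2 (real n + 1) / real n) \<longlonglongrightarrow> \<mu> * bin_entropy (\<kappa> / \<mu>)"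
    by simp
qed

lemma tendsto_ceiling_mult_divide: "(\<lambda>n. of_int \<lceil>x * real n\<rceil> / real n) \<longlonglongrightarrow> x"
proof (rule tendsto_sandwich)
  show "\<forall>\<^sub>F n in sequentially. x * real n / real n \<le> of_int \<lceil>x * real n\<rceil> / real n"
    by (intro always_eventually allI divide_right_mono) simp_all
  show "\<forall>\<^sub>F n in sequentially. of_int \<lceil>x * real n\<rceil> / real n \<le> (x * real n + 1) / real n"
    by (intro always_eventually allI divide_right_mono) (simp_all add: of_int_ceiling_le_add_one)
  show "(\<lambda>n. x * real n / real n) \<longlonglongrightarrow> x" and "(\<lambda>n. (x * real n + 1) / real n) \<longlonglongrightarrow> x"
    by real_asymp+
qed

lemma eventually_log_S_val_front_system_less:
  fixes A :: "nat \<Rightarrow> nat set" and b :: "nat \<Rightarrow> nat"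
  assumes A: "\<And>n. A n \<subseteq> {1..n}" and b: "\<And>n. b n \<le> card (A n)" "\<And>n. card (A n) \<le> 2 * b n"
    and lim: "(\<lambda>n. real (card (A n)) / real n) \<longlonglongrightarrow> \<alpha>" "(\<lambda>n. real (b n) / real n) \<longlonglongrightarrow> \<beta>"
    and less: "max \<alpha> (1 - \<alpha> + \<alpha> * bin_entropy (\<beta> / \<alpha>)) < s"
  shows "\<forall>\<^sub>F n in sequentially. log 2 (S_val n (front_system n (A n) (b n))) < s"
proof -
  define a where "a n = real (card (A n))" for n
  define h where "h n = a n * bin_entropy (real (b n) / a n)" for n
  define bound where
    "bound n = 1 / real n + max (a n / real n) (real n / real n - a n / real n + h n / real n)" for n
  have "(\<lambda>n. 1 / real n) \<longlonglongrightarrow> 0" and "(\<lambda>n. real n / real n) \<longlonglongrightarrow> 1"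
    by real_asymp+
  moreover have "(\<lambda>n. a n / real n) \<longlonglongrightarrow> \<alpha>"
    using lim(1) by (simp add: a_def)
  moreover have "(\<lambda>n. h n / real n) \<longlonglongrightarrow> \<alpha> * bin_entropy (\<beta> / \<alpha>)"
    unfolding a_def h_def using b(1) lim by (rule tendsto_mult_bin_entropy_ratio)
  ultimately have "bound \<longlonglongrightarrow> 0 + max \<alpha> (1 - \<alpha> + \<alpha> * bin_entropy (\<beta> / \<alpha>))"
    unfolding bound_def by (intro tendsto_intros)
  then have "\<forall>\<^sub>F n in sequentially. bound n < s"
    using less by (auto dest: order_tendstoD)
  moreover have "log 2 (S_val n (front_system n (A n) (b n))) \<le> bound n" for n
  proof -
    have "log 2 (S_val n (front_system n (A n) (b n)))
      \<le> (1 + max (a n) (real n - a n + h n)) / real n"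
      unfolding a_def h_def using A b by (rule log_S_val_front_system_le)
    also have "\<dots> = bound n"
      unfolding bound_def by (cases "n = 0")
        (simp_all add: add_divide_distrib diff_divide_distrib max_divide_distrib_right)
    finally show ?thesis .
  qed
  ultimately show ?thesis
    by (elim eventually_mono) (rule le_less_trans)
qed

lemma tendsto_elg_P_val_front_system:
  fixes A :: "nat \<Rightarrow> nat set" and b :: "nat \<Rightarrow> nat"
  assumes A: "\<And>n. A n \<subseteq> {1..n}" and b: "\<And>n. b n \<le> card (A n)"
    and lim: "(\<lambda>n. real (card (A n)) / real n) \<longlonglongrightarrow> \<alpha>" "(\<lambda>n. real (b n) / real n) \<longlonglongrightarrow> \<beta>"
  shows "(\<lambda>n. elg (P_val n (front_system n (A n) (b n))))
    \<longlonglongrightarrow> ereal (bin_entropy \<alpha> - (1 - \<beta>) * bin_entropy ((\<alpha> - \<beta>) / (1 - \<beta>)))"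
proof -
  have a: "card (A n) \<le> n" for n
    using A by (rule card_subset_atLeastAtMost_le)
  have one: "(\<lambda>n. real n / real n) \<longlonglongrightarrow> 1"
    by real_asymp
  have "(\<lambda>n. log 2 (real (n choose card (A n))) / real n) \<longlonglongrightarrow> 1 * bin_entropy (\<alpha> / 1)"
    using a order_refl one lim(1) by (rule tendsto_log_choose)
  moreover have "(\<lambda>n. log 2 (real ((n - b n) choose (card (A n) - b n))) / real n)
    \<longlonglongrightarrow> (1 - \<beta>) * bin_entropy ((\<alpha> - \<beta>) / (1 - \<beta>))"
  proof (rule tendsto_log_choose)
    show "(\<lambda>n. real (n - b n) / real n) \<longlonglongrightarrow> 1 - \<beta>"
      using tendsto_diff[OF one lim(2)] order_trans[OF b a]
      by (simp add: of_nat_diff diff_divide_distrib)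
    show "(\<lambda>n. real (card (A n) - b n) / real n) \<longlonglongrightarrow> \<alpha> - \<beta>"
      using tendsto_diff[OF lim] b by (simp add: of_nat_diff diff_divide_distrib)
  qed (use a in \<open>simp_all add: diff_le_mono\<close>)
  ultimately show ?thesis
    unfolding elg_P_val_front_system[OF A b] diff_divide_distrib
    by (intro tendsto_ereal tendsto_diff) simp_all
qed

theorem theorem4p5:
  fixes \<epsilon> \<alpha> \<beta> :: real
  assumes "\<epsilon> > 0"
    and "0 < \<alpha>" and "\<alpha> \<le> 1"
    and "\<alpha> / 2 \<le> \<beta>" and "\<beta> \<le> \<alpha>"
  shows "\<exists>n F. n \<ge> 1 \<and> set_system n F \<and> regularly_self_intersecting n F \<and>
    log 2 (S_val n F) \<le> max \<alpha> ((1 - \<alpha>) + \<alpha> * bin_entropy (\<beta> / \<alpha>)) + \<epsilon> \<and>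
    elg (P_val n F) \<le>
      ereal (bin_entropy \<alpha> - (1 - \<beta>) * bin_entropy ((\<alpha> - \<beta>) / (1 - \<beta>)) + \<epsilon>)"
proof -
  define A b where "A n = {1..nat \<lceil>\<alpha> * real n\<rceil>}" and "b n = nat \<lceil>\<beta> * real n\<rceil>" for n
  let ?F = "\<lambda>n. front_system n (A n) (b n)"
  have A: "A n \<subseteq> {1..n}" for n
    using assms by (simp add: A_def nat_le_iff ceiling_le_iff mult_left_le_one_le)
  have b: "b n \<le> card (A n)" "card (A n) \<le> 2 * b n" for n
    using mult_right_mono[OF assms(4), of "real n"] mult_right_mono[OF assms(5), of "real n"]
      real_nat_ceiling_ge[of "\<alpha> * real n"] real_nat_ceiling_ge[of "\<beta> * real n"]
    by (simp_all add: A_def b_def) linarith+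
  have lim: "(\<lambda>n. real (card (A n)) / real n) \<longlonglongrightarrow> \<alpha>" "(\<lambda>n. real (b n) / real n) \<longlonglongrightarrow> \<beta>"
    using assms by (simp_all add: A_def b_def tendsto_ceiling_mult_divide)
  have "\<forall>\<^sub>F n in sequentially.
      log 2 (S_val n (?F n)) < max \<alpha> ((1 - \<alpha>) + \<alpha> * bin_entropy (\<beta> / \<alpha>)) + \<epsilon>"
    using A b lim by (rule eventually_log_S_val_front_system_less) (use assms(1) in simp)
  moreover have "\<forall>\<^sub>F n in sequentially. elg (P_val n (?F n))
      < ereal (bin_entropy \<alpha> - (1 - \<beta>) * bin_entropy ((\<alpha> - \<beta>) / (1 - \<beta>)) + \<epsilon>)"
    using tendsto_elg_P_val_front_system[OF A b(1) lim]
    by (rule order_tendstoD) (use assms(1) in simp)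
  moreover have "regularly_self_intersecting n (?F n)" for n
    using A order_trans[OF b(1) card_subset_atLeastAtMost_le[OF A]]
    by (rule regularly_self_intersecting_front_system)
  ultimately show ?thesis
    using set_system_front_system less_imp_le
      eventually_happens'[OF sequentially_bot
        eventually_conj[OF eventually_ge_at_top[of 1] eventually_conj]]
    by meson
qed

end
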